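(* Let $\{\alpha_m\}_{m=1}^N\subset K$. If $(\{f_m\}_{m=1}^N,\{g_m\}_{m=1}^N)\in \tilde{S}(\{\alpha_m\}_{m=1}^N)$ is a critical pair of sequences, then: (1) for each $m\in\{1,\dots,N\}$, $f_m$ is an eigenvector of $TU^\star$ and $g_m$ is an eigenvector of $UT^\star$, and the corresponding eigenvalues are (complex) conjugates of each other; (2) if $\{\lambda_j\}_{j=1}^J$ is the sequence of distinct eigenvalues of $TU^\star$, there exists a sequence of index sets $\{I_j\}_{j=1}^J$ with $\bigcup_{j=1}^J I_j=\{1,\dots,N\}$ such that, for each $j=1,\dots,J$, $\{f_m\}_{m\in I_j}$ and $\{g_m\}_{m\in I_j}$ are $\lambda_j$-generalized dual frames.
   Context: $K$ is $\mathbb{R}$ or $\mathbb{C}$, and $\mathbb{H}_d$ is a $d$-dimensional Hilbert space over $K$ with inner product $\langle\cdot,\cdot\rangle$ linear in the first argument. For sequences $\{f_m\}_{m=1}^N,\{g_m\}_{m=1}^N$ in $\mathbb{H}_d$, the mixed frame operators are $$TU^\star(f)=\sum_{m=1}^N\langle f,g_m\rangle f_m,\qquad UT^\star(f)=\sum_{m=1}^N\langle f,f_m\rangle g_m\qquad (f\in\mathbb{H}_d).$$ For $\{\alpha_m\}_{m=1}^N\subset K$, $\tilde{S}(\{\alpha_m\}_{m=1}^N)=\{(\{f_m\}_{m=1}^N,\{g_m\}_{m=1}^N)\in\mathbb{H}_d^N\times\mathbb{H}_d^N:\langle f_m,g_m\rangle=\alpha_m\ \forall m=1,\dots,N\}$.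 A pair $(\{f_m\}_{m=1}^N,\{g_m\}_{m=1}^N)\in\tilde{S}(\{\alpha_m\}_{m=1}^N)$ is a critical pair of sequences if for each $m=1,\dots,N$ there exists $c\in K$ (depending on $m$) such that $$\sum_{n=1,n\neq m}^N\langle f_m,g_n\rangle f_n=c f_m\quad\text{and}\quad\sum_{n=1,n\neq m}^N\langle g_m,f_n\rangle g_n=\overline{c}\,g_m .$$ For a finite index set $\mathcal{L}$ and $A\in K$, $\{f_m\}_{m\in\mathcal{L}}\subset\mathbb{H}_d$ and $\{g_m\}_{m\in\mathcal{L}}\subset\mathbb{H}_d$ are $A$-generalized dual frames if $\sum_{m\in\mathcal{L}}\langle f,g_m\rangle f_m=Af$ for all $f\in \mathrm{span}\{f_m\}_{m\in\mathcal{L}}$ and $\sum_{m\in\mathcal{L}}\langle f,f_m\rangle g_m=\overline{A}f$ for all $f\in \mathrm{span}\{g_m\}_{m\in\mathcal{L}}$. Convention: the zero vector is admitted as an eigenvector, i.e. $v$ is called an eigenvector of an operator $M$ for its eigenvalue $\lambda$ if $Mv=\lambda v$. *)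

theory Defs
  imports Complex_Main
begin

text \<open>
  The scalar field: up to isomorphism, a field with conjugation in this class is either the reals
  with the identity (the case \<open>i = 0\<close>) or the complex numbers with complex conjugation (the case
  \<open>i * i = - 1\<close>).
\<close>

class real_or_complex = real_field +
  fixes conjugate :: "'a \<Rightarrow> 'a"
  assumes real_or_complex:
    "\<exists>i. (i = 0 \<or> i * i = - 1) \<and>
         (\<forall>z. \<exists>a b. z = a *\<^sub>R 1 + b *\<^sub>R i \<and> conjugate z = a *\<^sub>R 1 - b *\<^sub>R i)"

instantiation real :: real_or_complex
begin
definition conjugate_real :: "real \<Rightarrow> real" where "conjugate_real x = x"
instance
  by standard (rule exI[of _ 0], simp add: conjugate_real_def)
end

instantiation complex :: real_or_complex
begin
definition conjugate_complex :: "complex \<Rightarrow> complex" where "conjugate_complex z = cnj z"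
instance
proof
  have "\<exists>a b. z = a *\<^sub>R 1 + b *\<^sub>R \<i> \<and> conjugate z = a *\<^sub>R 1 - b *\<^sub>R \<i>" for z
    by (rule exI[of _ "Re z"], rule exI[of _ "Im z"])
       (simp add: conjugate_complex_def complex_eq_iff)
  then show "\<exists>i::complex. (i = 0 \<or> i * i = - 1) \<and>
      (\<forall>z. \<exists>a b. z = a *\<^sub>R 1 + b *\<^sub>R i \<and> conjugate z = a *\<^sub>R 1 - b *\<^sub>R i)"
    by (intro exI[of _ "\<i>"]) simp
qed
end

text \<open>
  Completeness is automatic in finite dimension.  The finite spanning set is required separately
  because \<^const>\<open>vector_space.dim\<close> is 0 on infinite-dimensional spaces.
\<close>

locale fd_hilbert_space = vector_space scale
  for scale :: "'k::real_or_complex \<Rightarrow> 'v::ab_group_add \<Rightarrow> 'v" (infixr "*s" 75) +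
  fixes ip :: "'v \<Rightarrow> 'v \<Rightarrow> 'k"
    and d :: nat
  assumes ip_add_left: "ip (x + y) z = ip x z + ip y z"
    and ip_scale_left: "ip (c *s x) y = c * ip x y"
    and ip_commute: "ip y x = conjugate (ip x y)"
    and ip_self_nonneg: "\<exists>r\<ge>0. ip x x = of_real r"
    and ip_self_eq_0: "ip x x = 0 \<Longrightarrow> x = 0"
    and finite_spanning: "\<exists>B. finite B \<and> span B = UNIV"
    and dim_UNIV: "dim UNIV = d"
begin

text \<open>
  A sequence indexed by \<open>1, \<dots>, N\<close> is a function on \<^typ>\<open>nat\<close> of which only the values on
  \<open>{1..N}\<close> matter.
\<close>

definition TU_star :: "nat \<Rightarrow> (nat \<Rightarrow> 'v) \<Rightarrow> (nat \<Rightarrow> 'v) \<Rightarrow> 'v \<Rightarrow> 'v" where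
  "TU_star N f g h = (\<Sum>m=1..N. ip h (g m) *s f m)"

definition UT_star :: "nat \<Rightarrow> (nat \<Rightarrow> 'v) \<Rightarrow> (nat \<Rightarrow> 'v) \<Rightarrow> 'v \<Rightarrow> 'v" where
  "UT_star N f g h = (\<Sum>m=1..N. ip h (f m) *s g m)"

definition S_tilde :: "nat \<Rightarrow> (nat \<Rightarrow> 'k) \<Rightarrow> ((nat \<Rightarrow> 'v) \<times> (nat \<Rightarrow> 'v)) set" where
  "S_tilde N \<alpha> = {(f, g). \<forall>m\<in>{1..N}. ip (f m) (g m) = \<alpha> m}"

definition critical_pair :: "nat \<Rightarrow> (nat \<Rightarrow> 'k) \<Rightarrow> (nat \<Rightarrow> 'v) \<Rightarrow> (nat \<Rightarrow> 'v) \<Rightarrow> bool" where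
  "critical_pair N \<alpha> f g \<longleftrightarrow> (f, g) \<in> S_tilde N \<alpha> \<and>
     (\<forall>m\<in>{1..N}. \<exists>c.
        (\<Sum>n\<in>{1..N} - {m}. ip (f m) (g n) *s f n) = c *s f m \<and>
        (\<Sum>n\<in>{1..N} - {m}. ip (g m) (f n) *s g n) = conjugate c *s g m)"

definition gen_dual_frames :: "'k \<Rightarrow> 'i set \<Rightarrow> ('i \<Rightarrow> 'v) \<Rightarrow> ('i \<Rightarrow> 'v) \<Rightarrow> bool" where
  "gen_dual_frames A L f g \<longleftrightarrow> finite L \<and>
     (\<forall>h\<in>span (f ` L). (\<Sum>m\<in>L. ip h (g m) *s f m) = A *s h) \<and>
     (\<forall>h\<in>span (g ` L). (\<Sum>m\<in>L. ip h (f m) *s g m) = conjugate A *s h)"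

definition eigenvalue_of :: "('v \<Rightarrow> 'v) \<Rightarrow> 'k \<Rightarrow> bool" where
  "eigenvalue_of M l \<longleftrightarrow> (\<exists>v. v \<noteq> 0 \<and> M v = l *s v)"

text \<open>
  The zero vector counts as an eigenvector, but only for a scalar that is an eigenvalue in the
  usual sense.
\<close>

definition eigenvector_for :: "('v \<Rightarrow> 'v) \<Rightarrow> 'k \<Rightarrow> 'v \<Rightarrow> bool" where
  "eigenvector_for M l v \<longleftrightarrow> eigenvalue_of M l \<and> M v = l *s v"

end

end

theory Submission
  imports Defs
begin

text \<open>
  Criticality says \<open>TU\<^sup>\<star> f\<^sub>m = \<lambda>\<^sub>m f\<^sub>m\<close> and \<open>UT\<^sup>\<star> g\<^sub>m = cnj \<lambda>\<^sub>m g\<^sub>m\<close> with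
  \<open>\<lambda>\<^sub>m = c + \<alpha>\<^sub>m\<close>.  This \<open>\<lambda>\<^sub>m\<close> is a genuine eigenvalue of \<open>TU\<^sup>\<star>\<close> unless \<open>f\<^sub>m = 0\<close>; if then
  \<open>g\<^sub>m \<noteq> 0\<close>, it still is one because \<open>UT\<^sup>\<star>\<close> is the adjoint of \<open>TU\<^sup>\<star>\<close> in finite dimension.  If both
  vanish, \<open>\<lambda>\<^sub>m\<close> may be replaced by any eigenvalue, and there is one even over the reals: either
  some other pair provides it, or \<open>TU\<^sup>\<star> = 0\<close>.  Finally \<open>\<lambda>\<^sub>n \<langle>f\<^sub>n, g\<^sub>m\<rangle> = \<lambda>\<^sub>m \<langle>f\<^sub>n, g\<^sub>m\<rangle>\<close> by adjointness,
  so \<open>f\<^sub>n\<close> and \<open>g\<^sub>m\<close> are orthogonal whenever \<open>\<lambda>\<^sub>n \<noteq> \<lambda>\<^sub>m\<close>, and the index sets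
  \<open>I\<^sub>j = {m. \<lambda>\<^sub>m = \<lambda>\<^sub>j}\<close> decouple.
\<close>

section \<open>Conjugation on the scalar field\<close>

lemma conjugate_cases:
  obtains "\<And>z::'k::real_or_complex. conjugate z = z"
  | i :: "'k::real_or_complex"
  where "i * i = - 1" "\<And>z. \<exists>a b. z = of_real a + of_real b * i"
    "\<And>a b. conjugate (of_real a + of_real b * i) = of_real a - of_real b * i"
proof -
  obtain i :: 'k where i: "i = 0 \<or> i * i = - 1"
    and rep: "\<And>z. \<exists>a b. z = a *\<^sub>R 1 + b *\<^sub>R i \<and> conjugate z = a *\<^sub>R 1 - b *\<^sub>R i"
    using real_or_complex by blast
  show ?thesis
  proof (cases "i = 0")
    case True
    have "conjugate z = z" for z :: 'k
      using rep[of z] True by auto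
    then show ?thesis by (rule that(1))
  next
    case False
    with i have i2: "i * i = - 1" by blast
    have rep': "\<exists>a b. z = of_real a + of_real b * i \<and> conjugate z = of_real a - of_real b * i" for z
      using rep[of z] by (simp add: scaleR_conv_of_real)
    \<comment> \<open>The class axiom yields the conjugate for one representation of each scalar;
      uniqueness of the real coordinates carries it over to every representation.\<close>
    have "conjugate (of_real a + of_real b * i) = of_real a - of_real b * i" for a b
    proof -
      obtain a' b' where eq: "of_real a + of_real b * i = of_real a' + of_real b' * i"
        and cj: "conjugate (of_real a + of_real b * i) = of_real a' - of_real b' * i"
        using rep' by blast
      have "of_real (a - a') = of_real (b' - b) * i"
        using eq by (simp add: algebra_simps)
      \<comment> \<open>Squaring removes \<open>i\<close>: a real square equals minus a real square,
        so both vanish.\<close>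
      then have "of_real (a - a') * of_real (a - a')
          = (of_real (b' - b) * of_real (b' - b)) * (i * i)"
        by (simp only: ac_simps)
      then have "(of_real ((a - a')\<^sup>2) :: 'k) = of_real (- (b' - b)\<^sup>2)"
        by (simp only: i2 of_real_minus of_real_mult power2_eq_square mult_minus_right mult_1_right)
      then have "(a - a')\<^sup>2 = - (b' - b)\<^sup>2"
        by (simp only: of_real_eq_iff)
      then have "(a - a')\<^sup>2 + (b' - b)\<^sup>2 = 0" by simp
      then have "a = a'" "b = b'" by (simp_all add: sum_power2_eq_zero_iff)
      with cj show ?thesis by simp
    qed
    then show ?thesis using that(2) i2 rep' by meson
  qed
qed

lemma conjugate_add [simp]: "conjugate (x + y) = conjugate x + conjugate y"
  for x y :: "'k::real_or_complex"
proof (cases rule: conjugate_cases[where 'k = 'k])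
  case 1
  then show ?thesis by simp
next
  case (2 i)
  obtain a b a' b' where xy: "x = of_real a + of_real b * i" "y = of_real a' + of_real b' * i"
    using 2(2) by meson
  have "x + y = of_real (a + a') + of_real (b + b') * i"
    by (simp add: xy algebra_simps)
  then have xy': "conjugate (x + y) = of_real (a + a') - of_real (b + b') * i"
    using 2(3) by metis
  have cj: "conjugate x = of_real a - of_real b * i" "conjugate y = of_real a' - of_real b' * i"
    using 2(3) xy by auto
  show ?thesis
    unfolding xy' cj by (simp add: algebra_simps)
qed

lemma conjugate_mult [simp]: "conjugate (x * y) = conjugate x * conjugate y"
  for x y :: "'k::real_or_complex"
proof (cases rule: conjugate_cases[where 'k = 'k])
  case 1
  then show ?thesis by simp
next
  case (2 i)
  obtain a b a' b' where xy: "x = of_real a + of_real b * i" "y = of_real a' + of_real b' * i"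
    using 2(2) by meson
  have i2: "i * (i * z) = - z" for z
    by (simp add: 2(1) flip: mult.assoc)
  have "x * y = of_real (a * a' - b * b') + of_real (a * b' + b * a') * i"
    by (simp add: xy algebra_simps i2 2(1))
  then have xy': "conjugate (x * y) = of_real (a * a' - b * b') - of_real (a * b' + b * a') * i"
    using 2(3) by metis
  have cj: "conjugate x = of_real a - of_real b * i" "conjugate y = of_real a' - of_real b' * i"
    using 2(3) xy by auto
  show ?thesis
    unfolding xy' cj by (simp add: algebra_simps i2 2(1))
qed

lemma conjugate_conjugate [simp]: "conjugate (conjugate x) = x"
  for x :: "'k::real_or_complex"
proof (cases rule: conjugate_cases[where 'k = 'k])
  case 1
  then show ?thesis by simp
next
  case (2 i)
  obtain a b where x: "x = of_real a + of_real b * i"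
    using 2(2) by meson
  have "conjugate x = of_real a + of_real (- b) * i"
    unfolding x 2(3) by simp
  then have "conjugate (conjugate x) = of_real a - of_real (- b) * i"
    using 2(3) by metis
  then show ?thesis by (simp add: x)
qed

lemma conjugate_0 [simp]: "conjugate (0::'k::real_or_complex) = 0"
  using conjugate_add[of "0::'k" 0] by simp

lemma conjugate_sum: "conjugate (sum h A) = (\<Sum>x\<in>A. conjugate (h x :: 'k::real_or_complex))"
  by (induction A rule: infinite_finite_induct) simp_all

section \<open>Inner product and adjointness of the mixed frame operators\<close>

context fd_hilbert_space
begin

lemma ip_0_left [simp]: "ip 0 y = 0"
  using ip_add_left[of 0 0 y] by simp

lemma ip_sum_left: "ip (sum h A) y = (\<Sum>x\<in>A. ip (h x) y)"
  by (induction A rule: infinite_finite_induct) (simp_all add: ip_add_left)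

lemma ip_0_right [simp]: "ip x 0 = 0"
  by (metis ip_commute ip_0_left conjugate_0)

lemma ip_scale_right: "ip x (c *s y) = conjugate c * ip x y"
  by (metis ip_commute ip_scale_left conjugate_mult)

lemma ip_sum_right: "ip x (sum h A) = (\<Sum>y\<in>A. ip x (h y))"
proof -
  have "ip x (sum h A) = conjugate (ip (sum h A) x)" by (rule ip_commute)
  also have "\<dots> = (\<Sum>y\<in>A. ip x (h y))"
    by (simp add: ip_sum_left conjugate_sum ip_commute[symmetric])
  finally show ?thesis .
qed

text \<open>Lets facts about \<open>TU_star\<close> be reused for \<open>UT_star\<close> with the
  two sequences exchanged.\<close>

lemma UT_star_eq_TU_star_swap: "UT_star N f g = TU_star N g f"
  by (simp add: fun_eq_iff UT_star_def TU_star_def)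

lemma linear_TU_star: "Vector_Spaces.linear scale scale (TU_star N f g)"
  by unfold_locales
    (simp_all add: TU_star_def ip_add_left ip_scale_left scale_left_distrib sum.distrib
      scale_sum_right scale_right_distrib)

lemma ip_TU_star: "ip (TU_star N f g x) y = ip x (UT_star N f g y)"
  by (simp add: TU_star_def UT_star_def ip_sum_left ip_sum_right ip_scale_left ip_scale_right
      ip_commute[symmetric] mult.commute)

text \<open>Otherwise \<open>TU_star - l\<close> would be injective, hence surjective in finite
  dimension. By adjointness its range is orthogonal to \<open>y\<close>, so \<open>y\<close> would
  be orthogonal to itself.\<close>

lemma eigenvalue_of_TU_star_if_UT_star:
  assumes g: "UT_star N f g y = conjugate l *s y" and "y \<noteq> 0"
  shows "eigenvalue_of (TU_star N f g) l"
proof (rule ccontr)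
  assume no: "\<not> ?thesis"
  define D where "D = (\<lambda>x. TU_star N f g x - l *s x)"
  interpret T: Vector_Spaces.linear scale scale "TU_star N f g" by (rule linear_TU_star)
  have lin: "Vector_Spaces.linear scale scale D"
    by unfold_locales (simp_all add: D_def T.add T.scale algebra_simps)
  interpret D: Vector_Spaces.linear scale scale D by (rule lin)
  have "inj D"
    unfolding D.inj_iff_eq_0 using no by (auto simp: D_def eigenvalue_of_def)
  obtain B where B: "independent B" "span B = UNIV" "finite B"
    using finite_spanning basis_exists[of UNIV] independent_span_bound
    by (metis top.extremum_uniqueI subset_UNIV)
  interpret finite_dimensional_vector_space scale B
    by unfold_locales (use B in auto)
  have "surj D"
    using lin \<open>inj D\<close> by (rule linear_inj_imp_surj)
  then obtain x where "D x = y" by (metis surjD)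
  then have "ip y y = ip (TU_star N f g x) y - ip (l *s x) y"
    by (metis D_def add_diff_cancel_right' diff_add_cancel ip_add_left)
  also have "\<dots> = 0"
    by (simp add: ip_TU_star g ip_scale_left ip_scale_right)
  finally show False
    using ip_self_eq_0 \<open>y \<noteq> 0\<close> by blast
qed

section \<open>Eigenvalues at a critical pair\<close>

lemma critical_pair_eigen_equations:
  assumes "critical_pair N \<alpha> f g" "m \<in> {1..N}"
  obtains l where "TU_star N f g (f m) = l *s f m" "UT_star N f g (g m) = conjugate l *s g m"
proof -
  obtain c where
    c1: "(\<Sum>n\<in>{1..N} - {m}. ip (f m) (g n) *s f n) = c *s f m" and
    c2: "(\<Sum>n\<in>{1..N} - {m}. ip (g m) (f n) *s g n) = conjugate c *s g m"
    using assms unfolding critical_pair_def by blast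
  \<comment> \<open>The term \<open>n = m\<close>, left out of the criticality condition, adds
    \<open>ip (f m) (g m)\<close> to \<open>c\<close>; in the equation for \<open>g\<close> it adds
    the conjugate.\<close>
  have "TU_star N f g (f m) = (ip (f m) (g m) + c) *s f m"
    using assms(2) by (simp add: TU_star_def sum.remove[of _ m] c1 scale_left_distrib del: One_nat_def)
  moreover have "UT_star N f g (g m) = conjugate (ip (f m) (g m) + c) *s g m"
    using assms(2) by (simp add: UT_star_def sum.remove[of _ m] c2 scale_left_distrib
        ip_commute[symmetric] del: One_nat_def)
  ultimately show ?thesis by (rule that)
qed

text \<open>Supplies the eigenvector that makes 0 an eigenvalue of the zero operator.\<close>

lemma ex_nonzero:
  assumes "d \<ge> 1"
  shows "\<exists>v::'v. v \<noteq> 0"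
proof (rule ccontr)
  assume "\<not> ?thesis"
  then have "UNIV = span {}" by auto
  then have "dim UNIV = 0"
    using dim_eq_card_independent[of "{}"] independent_empty by (metis card.empty dim_span)
  with assms dim_UNIV show False by simp
qed

text \<open>A real operator may lack eigenvalues, but here any nonzero \<open>f m\<close> is an
  eigenvector, and if there is none the operator is zero.\<close>

lemma critical_pair_ex_eigenvalue:
  assumes "critical_pair N \<alpha> f g" "d \<ge> 1"
  shows "\<exists>l. eigenvalue_of (TU_star N f g) l"
proof (cases "\<exists>m\<in>{1..N}. f m \<noteq> 0")
  case True
  then show ?thesis
    by (meson assms(1) critical_pair_eigen_equations eigenvalue_of_def)
next
  case False
  then have "TU_star N f g v = 0 *s v" for v
    by (simp add: TU_star_def)
  then show ?thesis
    using ex_nonzero[OF assms(2)] unfolding eigenvalue_of_def by blast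
qed

lemma critical_pair_conjugate_eigenvalues:
  assumes "critical_pair N \<alpha> f g" "d \<ge> 1" "m \<in> {1..N}"
  shows "\<exists>l. eigenvector_for (TU_star N f g) l (f m) \<and>
    eigenvector_for (UT_star N f g) (conjugate l) (g m)"
proof -
  \<comment> \<open>The adjoint argument for the exchanged sequences; conjugating twice gives back
    \<open>l\<close>.\<close>
  have adj: "eigenvalue_of (UT_star N f g) (conjugate l)" if "eigenvalue_of (TU_star N f g) l" for l
    using that eigenvalue_of_TU_star_if_UT_star[of N g f _ "conjugate l"]
    by (auto simp: eigenvalue_of_def[of "TU_star N f g"] UT_star_eq_TU_star_swap)
  obtain l where l: "TU_star N f g (f m) = l *s f m" "UT_star N f g (g m) = conjugate l *s g m"
    using critical_pair_eigen_equations assms by blast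
  show ?thesis
  proof (cases "f m = 0 \<and> g m = 0")
    \<comment> \<open>The equations hold for every scalar here, so any genuine eigenvalue
      serves.\<close>
    case True
    then show ?thesis
      using critical_pair_ex_eigenvalue[OF assms(1,2)] adj
      by (auto simp: eigenvector_for_def TU_star_def UT_star_def)
  next
    case False
    then have "eigenvalue_of (TU_star N f g) l"
      using l eigenvalue_of_TU_star_if_UT_star unfolding eigenvalue_of_def by blast
    with l adj show ?thesis
      unfolding eigenvector_for_def by blast
  qed
qed

section \<open>Orthogonality and partial frame sums\<close>

lemma ip_eq_0_if_eigenvalues_differ:
  assumes "TU_star N f g x = l *s x" "UT_star N f g y = conjugate k *s y" "l \<noteq> k"
  shows "ip x y = 0"
proof -
  have "l * ip x y = ip x (UT_star N f g y)"
    using assms(1) ip_TU_star[of N f g x y] by (simp add: ip_scale_left)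
  also have "\<dots> = k * ip x y"
    using assms(2) by (simp add: ip_scale_right)
  finally show ?thesis using assms(3) by simp
qed

text \<open>On each \<open>f n\<close> with \<open>n \<in> I\<close> the terms outside
  \<open>I\<close> vanish by orthogonality, so the partial sum is the full \<open>TU_star\<close>;
  linearity extends this to the span.\<close>

lemma partial_frame_sum_eq_scale:
  assumes eig: "\<And>n. n \<in> I \<Longrightarrow> TU_star N f g (f n) = l *s f n"
    and orth: "\<And>n m. n \<in> I \<Longrightarrow> m \<in> {1..N} - I \<Longrightarrow> ip (f n) (g m) = 0"
    and "I \<subseteq> {1..N}" "h \<in> span (f ` I)"
  shows "(\<Sum>m\<in>I. ip h (g m) *s f m) = l *s h"
  using \<open>h \<in> span (f ` I)\<close>
proof (induction rule: span_induct_alt)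
  case base
  show ?case by simp
next
  case (step c x h)
  then obtain n where n: "n \<in> I" "x = f n" by blast
  have "(\<Sum>m\<in>I. ip x (g m) *s f m) = TU_star N f g x"
    unfolding TU_star_def using n orth \<open>I \<subseteq> {1..N}\<close> by (intro sum.mono_neutral_left) auto
  with eig n have x: "(\<Sum>m\<in>I. ip x (g m) *s f m) = l *s x" by simp
  have "(\<Sum>m\<in>I. ip (c *s x + h) (g m) *s f m)
      = c *s (\<Sum>m\<in>I. ip x (g m) *s f m) + (\<Sum>m\<in>I. ip h (g m) *s f m)"
    by (simp add: ip_add_left ip_scale_left scale_left_distrib sum.distrib scale_sum_right)
  then show ?case
    by (simp add: x step scale_right_distrib mult.commute)
qed

lemma gen_dual_frames_of_eigen_equations:
  assumes f: "\<And>m. m \<in> {1..N} \<Longrightarrow> TU_star N f g (f m) = l m *s f m"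
    and g: "\<And>m. m \<in> {1..N} \<Longrightarrow> UT_star N f g (g m) = conjugate (l m) *s g m"
  shows "gen_dual_frames a {m\<in>{1..N}. l m = a} f g"
proof -
  let ?I = "{m\<in>{1..N}. l m = a}"
  have orth: "ip (f n) (g m) = 0" if "n \<in> {1..N}" "m \<in> {1..N}" "l n \<noteq> l m" for n m
    using ip_eq_0_if_eigenvalues_differ f g that by blast
  have orth': "ip (g m) (f n) = 0" if "n \<in> {1..N}" "m \<in> {1..N}" "l n \<noteq> l m" for n m
    by (metis orth[OF that] ip_commute conjugate_0)
  have "(\<Sum>m\<in>?I. ip h (g m) *s f m) = a *s h" if "h \<in> span (f ` ?I)" for h
    by (rule partial_frame_sum_eq_scale[OF _ _ _ that]) (use f orth in auto)
  moreover have "(\<Sum>m\<in>?I. ip h (f m) *s g m) = conjugate a *s h" if "h \<in> span (g ` ?I)" for h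
    \<comment> \<open>Applied with \<open>f\<close> and \<open>g\<close> exchanged, hence the
      reversed orthogonality \<open>orth'\<close>.\<close>
    by (rule partial_frame_sum_eq_scale[OF _ _ _ that])
      (use g orth' in \<open>auto simp: UT_star_eq_TU_star_swap\<close>)
  ultimately show ?thesis by (simp add: gen_dual_frames_def)
qed

end

theorem theorem1:
  fixes scale :: "'k::real_or_complex \<Rightarrow> 'v::ab_group_add \<Rightarrow> 'v"
    and ip :: "'v \<Rightarrow> 'v \<Rightarrow> 'k"
    and d N :: nat
    and \<alpha> :: "nat \<Rightarrow> 'k"
    and f g :: "nat \<Rightarrow> 'v"
  assumes "fd_hilbert_space scale ip d"
    and "d \<ge> 1"
    and "(f, g) \<in> fd_hilbert_space.S_tilde ip N \<alpha>"
    and "fd_hilbert_space.critical_pair scale ip N \<alpha> f g"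
  shows "(\<forall>m\<in>{1..N}. \<exists>l \<mu>.
            fd_hilbert_space.eigenvector_for scale (fd_hilbert_space.TU_star scale ip N f g) l (f m) \<and>
            fd_hilbert_space.eigenvector_for scale (fd_hilbert_space.UT_star scale ip N f g) \<mu> (g m) \<and>
            \<mu> = conjugate l)
       \<and> (\<forall>(J::nat) (ls :: nat \<Rightarrow> 'k).
            bij_betw ls {1..J}
              {l. fd_hilbert_space.eigenvalue_of scale (fd_hilbert_space.TU_star scale ip N f g) l} \<longrightarrow>
            (\<exists>I :: nat \<Rightarrow> nat set.
               (\<Union>j\<in>{1..J}. I j) = {1..N} \<and>
               (\<forall>j\<in>{1..J}. fd_hilbert_space.gen_dual_frames scale ip (ls j) (I j) f g)))"
proof -
  interpret fd_hilbert_space scale ip d by (rule assms(1))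
  have ex: "\<exists>l. eigenvector_for (TU_star N f g) l (f m) \<and>
      eigenvector_for (UT_star N f g) (conjugate l) (g m)" if "m \<in> {1..N}" for m
    using critical_pair_conjugate_eigenvalues assms(2,4) that by blast
  \<comment> \<open>One eigenvalue is fixed per index, shared up to conjugation by both
    operators.\<close>
  then obtain l where l: "\<And>m. m \<in> {1..N} \<Longrightarrow> eigenvector_for (TU_star N f g) (l m) (f m)"
    "\<And>m. m \<in> {1..N} \<Longrightarrow> eigenvector_for (UT_star N f g) (conjugate (l m)) (g m)"
    by metis
  have "(\<Union>j\<in>{1..J}. {m\<in>{1..N}. l m = ls j}) = {1..N}"
    if "bij_betw ls {1..J} {l. eigenvalue_of (TU_star N f g) l}" for J :: nat and ls
  proof -
    have "l m \<in> ls ` {1..J}" if "m \<in> {1..N}" for m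
      using l(1)[OF that] \<open>bij_betw ls _ _\<close> by (simp add: eigenvector_for_def bij_betw_imp_surj_on)
    then show ?thesis by fastforce
  qed
  moreover have "gen_dual_frames a {m\<in>{1..N}. l m = a} f g" for a
    by (rule gen_dual_frames_of_eigen_equations) (use l in \<open>auto simp: eigenvector_for_def\<close>)
  ultimately have "\<exists>I. (\<Union>j\<in>{1..J}. I j) = {1..N} \<and> (\<forall>j\<in>{1..J}. gen_dual_frames (ls j) (I j) f g)"
    if "bij_betw ls {1..J} {l. eigenvalue_of (TU_star N f g) l}" for J :: nat and ls
    \<comment> \<open>An eigenvalue that equals no chosen \<open>l m\<close> receives the empty
      index set.\<close>
    using that by (intro exI[of _ "\<lambda>j. {m\<in>{1..N}. l m = ls j}"]) blast
  with ex show ?thesis by blast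
qed

end
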